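(* Let $\Delta$ be a twin building of type $(W,S)$ and let $\theta$ be an automorphism of $\Delta$. If $\theta$ is $\{s\}$-opposite for some $s\in S$, then $\theta$ is $S$-opposite, i.e. $\theta$ maps every chamber to an opposite chamber.
   Context: $(W,S)$ is a Coxeter system with $S$ finite and $W$ irreducible. A twin building consists of two buildings $\Delta^+,\Delta^-$ of type $(W,S)$ with a codistance $\delta^*$ satisfying the usual twin building axioms. A $K$-residue of $\Delta^\epsilon$ is a set $\{D\in\Delta^\epsilon:\delta(C,D)\in W_K\}$. Chambers in different halves are opposite if $\delta^*(C,D)=1$; residues $P,Q$ in different halves are opposite if every chamber of $P$ is opposite some chamber of $Q$. An automorphism is a bijection of chambers preserving adjacency and opposition (not necessarily type preserving). For $J\subseteq S$, $\theta$ is called $J$-opposite if it maps every $S\setminus J$-residue to an opposite residue. *)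

theory Defs
  imports "HOL-Algebra.Algebra"
begin

section \<open>Coxeter systems\<close>

definition word_prod :: "('w, 'x) monoid_scheme \<Rightarrow> 'w list \<Rightarrow> 'w" where
  "word_prod W ws = foldr (\<lambda>x y. x \<otimes>\<^bsub>W\<^esub> y) ws \<one>\<^bsub>W\<^esub>"

text \<open>
  The congruence on words over \<open>S\<close> generated by the relations \<open>(st)\<^sup>m = 1\<close>, where \<open>m\<close> is the
  order of \<open>st\<close>.  The library sets the order to \<open>0\<close> when it is infinite, so that
  no relation is imposed in that case; \<open>s = t\<close> gives \<open>m = 1\<close>, i.e. the relation \<open>ss = 1\<close>, so
  formal inverses of generators are not needed.
\<close>

inductive word_equiv :: "('w, 'x) monoid_scheme \<Rightarrow> 'w set \<Rightarrow> 'w list \<Rightarrow> 'w list \<Rightarrow> bool"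
  for W S where
  relation: "s \<in> S \<Longrightarrow> t \<in> S \<Longrightarrow>
      word_equiv W S (us @ concat (replicate (group.ord W (s \<otimes>\<^bsub>W\<^esub> t)) [s, t]) @ vs) (us @ vs)"
| refl: "word_equiv W S ws ws"
| sym: "word_equiv W S us vs \<Longrightarrow> word_equiv W S vs us"
| trans: "word_equiv W S us vs \<Longrightarrow> word_equiv W S vs ws \<Longrightarrow> word_equiv W S us ws"

locale coxeter_system = group W for W (structure) +
  fixes S
  assumes gens_closed: "S \<subseteq> carrier W"
    and generates: "generate W S = carrier W"
    and order_two: "s \<in> S \<Longrightarrow> ord s = 2"
    and presentation: "set ws \<subseteq> S \<Longrightarrow> word_prod W ws = \<one> \<Longrightarrow> word_equiv W S ws []"

definition cox_length :: "('w, 'x) monoid_scheme \<Rightarrow> 'w set \<Rightarrow> 'w \<Rightarrow> nat" where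
  "cox_length W S w =
     (LEAST n. \<exists>ws. set ws \<subseteq> S \<and> length ws = n \<and> word_prod W ws = w)"

definition coxeter_diagram :: "('w, 'x) monoid_scheme \<Rightarrow> 'w set \<Rightarrow> ('w \<times> 'w) set" where
  "coxeter_diagram W S =
     {(s, t). s \<in> S \<and> t \<in> S \<and> s \<noteq> t \<and> group.ord W (s \<otimes>\<^bsub>W\<^esub> t) \<noteq> 2}"

definition irreducible_coxeter :: "('w, 'x) monoid_scheme \<Rightarrow> 'w set \<Rightarrow> bool" where
  "irreducible_coxeter W S \<longleftrightarrow> (\<forall>s\<in>S. \<forall>t\<in>S. (s, t) \<in> (coxeter_diagram W S)\<^sup>*)"


section \<open>Buildings and twin buildings\<close>

locale building = coxeter_system W S for W (structure) and S +
  fixes Ch :: "'c set" and \<delta> :: "'c \<Rightarrow> 'c \<Rightarrow> 'a"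
  assumes chambers_nonempty: "Ch \<noteq> {}"
    and dist_closed: "C \<in> Ch \<Longrightarrow> D \<in> Ch \<Longrightarrow> \<delta> C D \<in> carrier W"
    and WD1: "C \<in> Ch \<Longrightarrow> D \<in> Ch \<Longrightarrow> \<delta> C D = \<one> \<longleftrightarrow> C = D"
    and WD2: "C \<in> Ch \<Longrightarrow> D \<in> Ch \<Longrightarrow> C' \<in> Ch \<Longrightarrow> s \<in> S \<Longrightarrow> \<delta> C' C = s \<Longrightarrow>
        \<delta> C' D \<in> {s \<otimes> \<delta> C D, \<delta> C D}"
    and WD2_longer: "C \<in> Ch \<Longrightarrow> D \<in> Ch \<Longrightarrow> C' \<in> Ch \<Longrightarrow> s \<in> S \<Longrightarrow> \<delta> C' C = s \<Longrightarrow>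
        cox_length W S (s \<otimes> \<delta> C D) = cox_length W S (\<delta> C D) + 1 \<Longrightarrow> \<delta> C' D = s \<otimes> \<delta> C D"
    and WD3: "C \<in> Ch \<Longrightarrow> D \<in> Ch \<Longrightarrow> s \<in> S \<Longrightarrow>
        \<exists>C'\<in>Ch. \<delta> C' C = s \<and> \<delta> C' D = s \<otimes> \<delta> C D"

text \<open>
  The two halves are indexed by a sign \<open>\<epsilon> :: bool\<close> (\<open>True\<close> for \<open>+\<close>), and realised as disjoint
  sets of one type, so that an automorphism is a map on \<open>Ch True \<union> Ch False\<close>.  The
  codistance \<open>\<delta>s\<close> is meaningful only for chambers in different halves.
\<close>

locale twin_building = coxeter_system W S for W (structure) and S +
  fixes Ch :: "bool \<Rightarrow> 'c set" and \<delta> :: "bool \<Rightarrow> 'c \<Rightarrow> 'c \<Rightarrow> 'a" and \<delta>s :: "'c \<Rightarrow> 'c \<Rightarrow> 'a"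
  assumes halves: "building W S (Ch \<epsilon>) (\<delta> \<epsilon>)"
    and disjoint: "Ch True \<inter> Ch False = {}"
    and codist_closed: "C \<in> Ch \<epsilon> \<Longrightarrow> D \<in> Ch (\<not> \<epsilon>) \<Longrightarrow> \<delta>s C D \<in> carrier W"
    and Tw1: "C \<in> Ch \<epsilon> \<Longrightarrow> D \<in> Ch (\<not> \<epsilon>) \<Longrightarrow> \<delta>s C D = inv (\<delta>s D C)"
    and Tw2: "C \<in> Ch \<epsilon> \<Longrightarrow> D \<in> Ch (\<not> \<epsilon>) \<Longrightarrow> C' \<in> Ch \<epsilon> \<Longrightarrow> s \<in> S \<Longrightarrow> \<delta> \<epsilon> C' C = s \<Longrightarrow>
        cox_length W S (s \<otimes> \<delta>s C D) < cox_length W S (\<delta>s C D) \<Longrightarrow> \<delta>s C' D = s \<otimes> \<delta>s C D"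
    and Tw3: "C \<in> Ch \<epsilon> \<Longrightarrow> D \<in> Ch (\<not> \<epsilon>) \<Longrightarrow> s \<in> S \<Longrightarrow>
        \<exists>C'\<in>Ch \<epsilon>. \<delta> \<epsilon> C' C = s \<and> \<delta>s C' D = s \<otimes> \<delta>s C D"


section \<open>Residues, opposition and automorphisms\<close>

definition twin_chambers :: "(bool \<Rightarrow> 'c set) \<Rightarrow> 'c set" where
  "twin_chambers Ch = Ch True \<union> Ch False"

definition is_residue ::
  "('w, 'x) monoid_scheme \<Rightarrow> 'w set \<Rightarrow> (bool \<Rightarrow> 'c set) \<Rightarrow> (bool \<Rightarrow> 'c \<Rightarrow> 'c \<Rightarrow> 'w) \<Rightarrow>
   'w set \<Rightarrow> bool \<Rightarrow> 'c set \<Rightarrow> bool" where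
  "is_residue W S Ch \<delta> K \<epsilon> R \<longleftrightarrow>
     K \<subseteq> S \<and> (\<exists>C\<in>Ch \<epsilon>. R = {D \<in> Ch \<epsilon>. \<delta> \<epsilon> C D \<in> generate W K})"

definition adjacent ::
  "'w set \<Rightarrow> (bool \<Rightarrow> 'c set) \<Rightarrow> (bool \<Rightarrow> 'c \<Rightarrow> 'c \<Rightarrow> 'w) \<Rightarrow> 'c \<Rightarrow> 'c \<Rightarrow> bool" where
  "adjacent S Ch \<delta> C D \<longleftrightarrow> (\<exists>\<epsilon>. C \<in> Ch \<epsilon> \<and> D \<in> Ch \<epsilon> \<and> \<delta> \<epsilon> C D \<in> S)"

definition opposite ::
  "('w, 'x) monoid_scheme \<Rightarrow> (bool \<Rightarrow> 'c set) \<Rightarrow> ('c \<Rightarrow> 'c \<Rightarrow> 'w) \<Rightarrow> 'c \<Rightarrow> 'c \<Rightarrow> bool" where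
  "opposite W Ch \<delta>s C D \<longleftrightarrow> (\<exists>\<epsilon>. C \<in> Ch \<epsilon> \<and> D \<in> Ch (\<not> \<epsilon>) \<and> \<delta>s C D = \<one>\<^bsub>W\<^esub>)"

definition opposite_residues ::
  "('w, 'x) monoid_scheme \<Rightarrow> 'w set \<Rightarrow> (bool \<Rightarrow> 'c set) \<Rightarrow> (bool \<Rightarrow> 'c \<Rightarrow> 'c \<Rightarrow> 'w) \<Rightarrow>
   ('c \<Rightarrow> 'c \<Rightarrow> 'w) \<Rightarrow> 'c set \<Rightarrow> 'c set \<Rightarrow> bool" where
  "opposite_residues W S Ch \<delta> \<delta>s P Q \<longleftrightarrow>
     (\<exists>\<epsilon> K L. is_residue W S Ch \<delta> K \<epsilon> P \<and> is_residue W S Ch \<delta> L (\<not> \<epsilon>) Q) \<and>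
     (\<forall>C\<in>P. \<exists>D\<in>Q. opposite W Ch \<delta>s C D)"

definition twin_automorphism ::
  "('w, 'x) monoid_scheme \<Rightarrow> 'w set \<Rightarrow> (bool \<Rightarrow> 'c set) \<Rightarrow> (bool \<Rightarrow> 'c \<Rightarrow> 'c \<Rightarrow> 'w) \<Rightarrow>
   ('c \<Rightarrow> 'c \<Rightarrow> 'w) \<Rightarrow> ('c \<Rightarrow> 'c) \<Rightarrow> bool" where
  "twin_automorphism W S Ch \<delta> \<delta>s \<theta> \<longleftrightarrow>
     bij_betw \<theta> (twin_chambers Ch) (twin_chambers Ch) \<and>
     (\<forall>C\<in>twin_chambers Ch. \<forall>D\<in>twin_chambers Ch.
        (adjacent S Ch \<delta> (\<theta> C) (\<theta> D) \<longleftrightarrow> adjacent S Ch \<delta> C D) \<and>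
        (opposite W Ch \<delta>s (\<theta> C) (\<theta> D) \<longleftrightarrow> opposite W Ch \<delta>s C D))"

definition J_opposite ::
  "('w, 'x) monoid_scheme \<Rightarrow> 'w set \<Rightarrow> (bool \<Rightarrow> 'c set) \<Rightarrow> (bool \<Rightarrow> 'c \<Rightarrow> 'c \<Rightarrow> 'w) \<Rightarrow>
   ('c \<Rightarrow> 'c \<Rightarrow> 'w) \<Rightarrow> 'w set \<Rightarrow> ('c \<Rightarrow> 'c) \<Rightarrow> bool" where
  "J_opposite W S Ch \<delta> \<delta>s J \<theta> \<longleftrightarrow>
     (\<forall>\<epsilon> R. is_residue W S Ch \<delta> (S - J) \<epsilon> R \<longrightarrow> opposite_residues W S Ch \<delta> \<delta>s R (\<theta> ` R))"

end

theory Submission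
  imports Defs
begin

text \<open>
  Write \<open>w(C)\<close> for the codistance from \<open>C\<close> to \<open>\<theta> C\<close>. Being \<open>{s}\<close>-opposite forces \<open>w(C) \<in> W\<^sub>K\<close>
  for every chamber \<open>C\<close>, where \<open>K = S - {s}\<close>. If this holds for some \<open>K\<close> and \<open>t \<notin> K\<close>, choose \<open>C'\<close>
  that is \<open>t\<close>-adjacent to \<open>C\<close> and has codistance \<open>t w(C)\<close> to \<open>\<theta> C\<close>; then \<open>w(C')\<close> is \<open>t w(C)\<close> or
  \<open>t w(C) u\<close> with \<open>u\<close> the type of the adjacency of \<open>\<theta> C\<close> and \<open>\<theta> C'\<close>. As \<open>w(C') \<in> W\<^sub>K\<close>, this
  leaves only \<open>u = t\<close> and \<open>t w(C) t \<in> W\<^sub>K\<close>, which happens only if \<open>w(C)\<close> lies in the subgroup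
  generated by the elements of \<open>K\<close> that commute with \<open>t\<close>. So a minimal \<open>K\<close> commutes elementwise with
  \<open>S - K\<close>, and is empty because \<open>W\<close> is irreducible. No map on types is needed, since \<open>\<theta>\<close> need
  not induce one.

  The facts on Coxeter groups come from the reflections
  \<open>s\<^sub>1 \<dots> s\<^sub>i\<^sub>-\<^sub>1 s\<^sub>i s\<^sub>i\<^sub>-\<^sub>1 \<dots> s\<^sub>1\<close> of a word \<open>s\<^sub>1 \<dots> s\<^sub>n\<close>: the parity of the number of times
  a given reflection occurs depends only on the product of the word.
\<close>

section \<open>Words and their reflection sequences\<close>

lemma word_prod_Nil [simp]: "word_prod W [] = \<one>\<^bsub>W\<^esub>"
  by (simp add: word_prod_def)

lemma word_prod_Cons [simp]: "word_prod W (x # xs) = x \<otimes>\<^bsub>W\<^esub> word_prod W xs"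
  by (simp add: word_prod_def)

text \<open>Conjugating all later entries by the head unfolds to the reflections named above.
  Writing \<open>inv x\<close> keeps the definition meaningful in any group.\<close>

fun reflections :: "('w, 'x) monoid_scheme \<Rightarrow> 'w list \<Rightarrow> 'w list" where
  "reflections W [] = []"
| "reflections W (x # xs) = x # map (\<lambda>r. x \<otimes>\<^bsub>W\<^esub> r \<otimes>\<^bsub>W\<^esub> inv\<^bsub>W\<^esub> x) (reflections W xs)"

lemma length_reflections [simp]: "length (reflections W ws) = length ws"
  by (induction ws) auto

lemma count_list_distinct: "distinct xs \<Longrightarrow> count_list xs x = (if x \<in> set xs then 1 else 0)"
  by (induction xs) auto

context group
begin

lemma conj_cancel:
  assumes "x \<in> carrier G" "y \<in> carrier G" "z \<in> carrier G"
  shows "x \<otimes> y \<otimes> inv x = x \<otimes> z \<otimes> inv x \<longleftrightarrow> y = z"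
  using assms by simp

lemma word_prod_closed [simp]: "set ws \<subseteq> carrier G \<Longrightarrow> word_prod G ws \<in> carrier G"
  by (induction ws) auto

lemma word_prod_append:
  "set us \<subseteq> carrier G \<Longrightarrow> set vs \<subseteq> carrier G \<Longrightarrow>
    word_prod G (us @ vs) = word_prod G us \<otimes> word_prod G vs"
  by (induction us) (auto simp: m_assoc)

lemma reflections_closed: "set ws \<subseteq> carrier G \<Longrightarrow> set (reflections G ws) \<subseteq> carrier G"
  by (induction ws) auto

lemma reflections_append:
  assumes "set us \<subseteq> carrier G" "set vs \<subseteq> carrier G"
  shows "reflections G (us @ vs) = reflections G us @
    map (\<lambda>r. word_prod G us \<otimes> r \<otimes> inv (word_prod G us)) (reflections G vs)"
  using assms
proof (induction us)
  case Nil
  then have "map (\<lambda>r. \<one> \<otimes> r \<otimes> inv \<one>) (reflections G vs) = map (\<lambda>r. r) (reflections G vs)"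
    using reflections_closed[of vs] by (intro map_cong) auto
  then show ?case by simp
next
  case (Cons a us)
  then show ?case
    using reflections_closed[of vs] by (auto simp: m_assoc inv_mult_group)
qed

text \<open>Write \<open>r = p b p^-1\<close> with \<open>b\<close> a letter and \<open>p\<close>
  the product of the prefix before it. Then \<open>r p = p b\<close>, so \<open>vs\<close> is
  \<open>ws\<close> with that letter dropped.\<close>

lemma exchange:
  assumes "set ws \<subseteq> carrier G" "r \<in> set (reflections G ws)"
  shows "\<exists>vs. set vs \<subseteq> set ws \<and> length ws = Suc (length vs) \<and>
    word_prod G ws = r \<otimes> word_prod G vs"
  using assms
proof (induction ws arbitrary: r)
  case Nil
  then show ?case by simp
next
  case (Cons a ws)
  show ?case
  proof (cases "r = a")
    case True
    then show ?thesis by (intro exI[of _ ws]) auto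
  next
    case False
    then obtain q where q: "q \<in> set (reflections G ws)" "r = a \<otimes> q \<otimes> inv a"
      using Cons.prems by auto
    with Cons obtain vs where vs: "set vs \<subseteq> set ws" "length ws = Suc (length vs)"
      "word_prod G ws = q \<otimes> word_prod G vs"
      by force
    moreover have "q \<in> carrier G"
      using q reflections_closed[of ws] Cons.prems by auto
    moreover have "set vs \<subseteq> carrier G"
      using vs Cons.prems by auto
    moreover from this have "inv a \<otimes> (a \<otimes> word_prod G vs) = word_prod G vs"
      using Cons.prems by (simp flip: m_assoc)
    ultimately have "word_prod G (a # ws) = r \<otimes> word_prod G (a # vs)"
      using Cons.prems q(2) by (simp add: m_assoc)
    then show ?thesis
      using vs by (intro exI[of _ "a # vs"]) auto
  qed
qed

end

section \<open>Parabolic subgroups of Coxeter groups\<close>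

context coxeter_system
begin

lemma gen_carrier [simp]: "s \<in> S \<Longrightarrow> s \<in> carrier W"
  using gens_closed by auto

lemma word_carrier: "set ws \<subseteq> S \<Longrightarrow> set ws \<subseteq> carrier W"
  using gens_closed by auto

lemma gen_square: "s \<in> S \<Longrightarrow> s \<otimes> s = \<one>"
  using order_two[of s] pow_ord_eq_1[of s] by (simp add: numeral_2_eq_2)

lemma inv_gen [simp]: "s \<in> S \<Longrightarrow> inv s = s"
  using gen_square[of s] by (simp add: inv_equality)

lemma gen_cancel [simp]: "s \<in> S \<Longrightarrow> x \<in> carrier W \<Longrightarrow> s \<otimes> (s \<otimes> x) = x"
  using gen_square[of s] by (simp flip: m_assoc)

lemma gen_neq_one: "s \<in> S \<Longrightarrow> s \<noteq> \<one>"
  using order_two[of s] by auto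

lemma word_prod_rev: "set ws \<subseteq> S \<Longrightarrow> word_prod W (rev ws) = inv (word_prod W ws)"
  by (induction ws) (auto simp: word_prod_append word_carrier inv_mult_group)

text \<open>Generators are their own inverses, so words without inverse letters suffice.\<close>

lemma generate_iff_word:
  assumes "K \<subseteq> S"
  shows "x \<in> generate W K \<longleftrightarrow> (\<exists>ws. set ws \<subseteq> K \<and> word_prod W ws = x)"
proof
  assume "x \<in> generate W K"
  then show "\<exists>ws. set ws \<subseteq> K \<and> word_prod W ws = x"
  proof (induction rule: generate.induct)
    case one
    show ?case by (intro exI[of _ "[]"]) simp
  next
    case (incl h)
    then show ?case using assms by (intro exI[of _ "[h]"]) auto
  next
    case (inv h)
    then show ?case using assms by (intro exI[of _ "[h]"]) (auto simp: subset_iff)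
  next
    case (eng h1 h2)
    then obtain us vs where "set us \<subseteq> K" "set vs \<subseteq> K"
      "word_prod W us = h1" "word_prod W vs = h2"
      by auto
    then show ?case
      using assms by (intro exI[of _ "us @ vs"]) (auto simp: word_prod_append word_carrier)
  qed
next
  assume "\<exists>ws. set ws \<subseteq> K \<and> word_prod W ws = x"
  then obtain ws where "set ws \<subseteq> K" "word_prod W ws = x" by blast
  then show "x \<in> generate W K"
    by (induction ws arbitrary: x) (auto intro: generate.intros)
qed

lemma subgroup_parabolic: "K \<subseteq> S \<Longrightarrow> subgroup (generate W K) W"
  using generate_is_subgroup gens_closed by blast

lemma parabolic_closed: "K \<subseteq> S \<Longrightarrow> x \<in> generate W K \<Longrightarrow> x \<in> carrier W"
  by (rule subgroup.mem_carrier[OF subgroup_parabolic])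

lemma reflections_parabolic:
  assumes "K \<subseteq> S" "set ws \<subseteq> K"
  shows "set (reflections W ws) \<subseteq> generate W K"
  using assms(2)
proof (induction ws)
  case (Cons a ws)
  then have "a \<in> generate W K" by (auto intro: generate.incl)
  with Cons subgroup_parabolic[OF assms(1)] show ?case
    by (auto intro!: subgroup.m_closed subgroup.m_inv_closed)
qed simp

section \<open>Parity of reflections as an invariant of words\<close>

lemma reflections_alternating:
  assumes "s \<in> S" "t \<in> S"
  shows "reflections W (concat (replicate n [s, t])) =
    map (\<lambda>j. (s \<otimes> t) [^] j \<otimes> s) [0..<2 * n]"
proof (induction n)
  case (Suc n)
  \<comment> \<open>Conjugation by \<open>s t\<close> raises the exponent by two; the two new
    letters supply the exponents \<open>0\<close> and \<open>1\<close>.\<close>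
  have shift: "s \<otimes> (t \<otimes> ((s \<otimes> t) [^] j \<otimes> s) \<otimes> t) \<otimes> s = (s \<otimes> t) [^] Suc (Suc j) \<otimes> s"
    for j :: nat
  proof -
    have "s \<otimes> (t \<otimes> ((s \<otimes> t) [^] j \<otimes> s) \<otimes> t) \<otimes> s = ((s \<otimes> t) \<otimes> (s \<otimes> t) [^] j) \<otimes> (s \<otimes> t) \<otimes> s"
      using assms by (simp add: m_assoc)
    also have "(s \<otimes> t) \<otimes> (s \<otimes> t) [^] j = (s \<otimes> t) [^] Suc j"
      using assms by (simp only: nat_pow_Suc2 m_closed gen_carrier)
    finally show ?thesis by simp
  qed
  have "[0..<Suc (Suc m)] = 0 # 1 # map (\<lambda>j. Suc (Suc j)) [0..<m]" for m
    by (induction m) auto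
  then have "[0..<2 * Suc n] = 0 # 1 # map (\<lambda>j. Suc (Suc j)) [0..<2 * n]"
    by (simp only: mult_Suc_right add_2_eq_Suc)
  with Suc show ?case
    using assms shift by (simp add: o_def)
qed simp

lemma word_prod_alternating:
  "s \<in> S \<Longrightarrow> t \<in> S \<Longrightarrow> word_prod W (concat (replicate n [s, t])) = (s \<otimes> t) [^] n"
proof (induction n)
  case (Suc n)
  then have "word_prod W (concat (replicate (Suc n) [s, t])) = (s \<otimes> t) \<otimes> (s \<otimes> t) [^] n"
    by (simp add: m_assoc)
  then show ?case
    using Suc.prems by (simp only: nat_pow_Suc2 m_closed gen_carrier)
qed simp

text \<open>
  The reflections of the word \<open>(st)\<^sup>m\<close> are \<open>(st)\<^sup>j s\<close> for \<open>j < 2 m\<close>; they have period \<open>m\<close>, hence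
  each occurs an even number of times.
\<close>

lemma reflections_relation:
  assumes "s \<in> S" "t \<in> S"
  shows "\<exists>xs. reflections W (concat (replicate (ord (s \<otimes> t)) [s, t])) = xs @ xs"
proof -
  let ?m = "ord (s \<otimes> t)" and ?f = "\<lambda>j::nat. (s \<otimes> t) [^] j \<otimes> s"
  have "[?m..<2 * ?m] = map (\<lambda>j. j + ?m) [0..<?m]"
    by (simp add: map_add_upt mult_2)
  then have "map ?f [?m..<2 * ?m] = map (\<lambda>j. ?f (j + ?m)) [0..<?m]"
    by (simp only: map_map comp_def)
  \<comment> \<open>For infinite order \<open>?m\<close> is \<open>0\<close>, and both halves are
    empty.\<close>
  moreover have "(s \<otimes> t) [^] (j + ?m) = (s \<otimes> t) [^] j" for j :: nat
    using assms nat_pow_mult[of "s \<otimes> t" j ?m] pow_ord_eq_1[of "s \<otimes> t"] by simp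
  ultimately have "map ?f [?m..<2 * ?m] = map ?f [0..<?m]"
    by simp
  then have "map ?f [0..<2 * ?m] = map ?f [0..<?m] @ map ?f [0..<?m]"
    using upt_add_eq_append[of 0 ?m ?m] by (simp add: mult_2)
  then show ?thesis
    using reflections_alternating[OF assms, of ?m] by auto
qed

text \<open>A relator contributes a list \<open>xs @ xs\<close> and, having trivial product, leaves
  later reflections alone. The claim about \<open>S\<close> is carried along because the parity
  claim needs it in the symmetric and transitive cases.\<close>

lemma word_equiv_invariants:
  assumes "word_equiv W S us vs"
  shows "(set us \<subseteq> S \<longleftrightarrow> set vs \<subseteq> S) \<and> (even (length us) \<longleftrightarrow> even (length vs)) \<and>
    (set us \<subseteq> S \<longrightarrow> (\<forall>r. even (count_list (reflections W us) r) \<longleftrightarrow>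
      even (count_list (reflections W vs) r)))"
  using assms
proof (induction rule: word_equiv.induct)
  case (relation s t us vs)
  define w where "w = concat (replicate (ord (s \<otimes> t)) [s, t])"
  have w: "set w \<subseteq> S" using relation by (auto simp: w_def set_replicate_conv_if)
  have one: "word_prod W w = \<one>" unfolding w_def
    using relation word_prod_alternating[of s t] pow_ord_eq_1[of "s \<otimes> t"] by simp
  obtain xs where xs: "reflections W w = xs @ xs"
    using reflections_relation relation unfolding w_def by blast
  have len: "even (length w)"
    by (simp add: w_def length_concat sum_list_replicate)
  have "even (count_list (reflections W (us @ w @ vs)) r) \<longleftrightarrow>
      even (count_list (reflections W (us @ vs)) r)" if "set us \<subseteq> S" "set vs \<subseteq> S" for r
  proof -
    have "map (\<lambda>r. \<one> \<otimes> r \<otimes> inv \<one>) (reflections W vs) = map (\<lambda>r. r) (reflections W vs)"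
      using reflections_closed[of vs] that word_carrier by (intro map_cong) auto
    then have "reflections W (w @ vs) = xs @ xs @ reflections W vs"
      using w that one xs by (subst reflections_append) (auto simp: word_carrier)
    then show ?thesis
      using that w by (auto simp: reflections_append word_carrier)
  qed
  then show ?case using w len unfolding w_def[symmetric] by auto
qed auto

text \<open>The presentation only treats words for the identity, so \<open>vs\<close> is moved over
  by reversing it.\<close>

lemma word_prod_eq_imp_equiv:
  assumes "set us \<subseteq> S" "set vs \<subseteq> S" "word_prod W us = word_prod W vs"
  shows "word_equiv W S (us @ rev vs) []"
  using assms by (intro presentation) (auto simp: word_prod_append word_prod_rev word_carrier)

lemma even_length_word:
  assumes "set us \<subseteq> S" "set vs \<subseteq> S" "word_prod W us = word_prod W vs"
  shows "even (length us) \<longleftrightarrow> even (length vs)"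
  using word_equiv_invariants[OF word_prod_eq_imp_equiv[OF assms]] by simp

text \<open>Both \<open>us @ rev vs\<close> and \<open>vs @ rev vs\<close> represent the identity.
  In each, the reflections of \<open>rev vs\<close> are conjugated by the same product, so their
  share cancels modulo 2.\<close>

lemma even_count_reflections:
  assumes "set us \<subseteq> S" "set vs \<subseteq> S" "word_prod W us = word_prod W vs"
  shows "even (count_list (reflections W us) r) \<longleftrightarrow> even (count_list (reflections W vs) r)"
  using word_equiv_invariants[OF word_prod_eq_imp_equiv[OF assms]]
    word_equiv_invariants[OF word_prod_eq_imp_equiv[OF assms(2,2) HOL.refl]] assms
  by (simp add: reflections_append word_carrier)

section \<open>Deletion and reduced words\<close>

lemma deletion:
  assumes "set ws \<subseteq> S" "\<not> distinct (reflections W ws)"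
  shows "\<exists>vs. set vs \<subseteq> set ws \<and> length vs < length ws \<and> word_prod W vs = word_prod W ws"
  using assms
proof (induction ws)
  case (Cons a ws)
  have inj: "inj_on (\<lambda>r. a \<otimes> r \<otimes> inv a) (set (reflections W ws))"
    using Cons.prems reflections_closed[of ws] word_carrier
    by (intro inj_onI) (auto simp: subset_iff)
  show ?case
  proof (cases "distinct (reflections W ws)")
    case True
    \<comment> \<open>The repetition involves the head, so \<open>a\<close> is also a reflection of
      \<open>ws\<close>. Exchange rewrites \<open>ws\<close> as \<open>a\<close> times a shorter
      word, and the two letters \<open>a\<close> cancel.\<close>
    then have "a \<in> (\<lambda>r. a \<otimes> r \<otimes> inv a) ` set (reflections W ws)"
      using Cons.prems inj by (auto simp: distinct_map)
    then obtain r where r: "r \<in> set (reflections W ws)" "a = a \<otimes> r \<otimes> inv a" by auto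
    moreover have "r \<in> carrier W"
      using r reflections_closed[of ws] Cons.prems word_carrier by auto
    moreover have "a \<otimes> a \<otimes> inv a = a" using Cons.prems by (simp add: m_assoc)
    ultimately have "r = a" using conj_cancel[of a r a] Cons.prems by auto
    then obtain vs where vs: "set vs \<subseteq> set ws" "length ws = Suc (length vs)"
      "word_prod W ws = a \<otimes> word_prod W vs"
      using exchange[of ws a] r Cons.prems word_carrier by auto
    then have "set vs \<subseteq> S" using Cons.prems by auto
    then show ?thesis
      using vs Cons.prems by (intro exI[of _ vs]) (auto simp: word_carrier)
  next
    case False
    with Cons obtain vs where "set vs \<subseteq> set ws" "length vs < length ws"
      "word_prod W vs = word_prod W ws"
      by auto
    then show ?thesis by (intro exI[of _ "a # vs"]) auto
  qed
qed simp

text \<open>Distinct reflections serve as the criterion for being reduced: they turn parity of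
  occurrences into membership. Deletion is iterated until this holds.\<close>

lemma reduced_word:
  assumes "K \<subseteq> S" "set ws \<subseteq> K"
  shows "\<exists>vs. set vs \<subseteq> K \<and> length vs \<le> length ws \<and> word_prod W vs = word_prod W ws \<and>
    distinct (reflections W vs)"
  using assms(2)
proof (induction ws rule: length_induct)
  case (1 ws)
  show ?case
  proof (cases "distinct (reflections W ws)")
    case True
    then show ?thesis using 1 by blast
  next
    case False
    then obtain us where us: "set us \<subseteq> set ws" "length us < length ws"
      "word_prod W us = word_prod W ws"
      using deletion[OF order_trans[OF 1(2) assms(1)] False] by blast
    with 1 obtain vs where "set vs \<subseteq> K" "length vs \<le> length us"
      "word_prod W vs = word_prod W us" "distinct (reflections W vs)"
      by (meson subset_trans)
    with us show ?thesis by (intro exI[of _ vs]) auto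
  qed
qed

section \<open>Generators and their conjugates in parabolic subgroups\<close>

lemma gen_in_parabolic:
  assumes "K \<subseteq> S" "t \<in> S" "t \<in> generate W K"
  shows "t \<in> K"
proof -
  obtain us where "set us \<subseteq> K" "word_prod W us = t"
    using assms generate_iff_word by blast
  then obtain ws where ws: "set ws \<subseteq> K" "word_prod W ws = t" "distinct (reflections W ws)"
    using reduced_word[OF assms(1)] by metis
  \<comment> \<open>The word \<open>[t]\<close> has the single reflection \<open>t\<close>; equal
    parities force the same for the reduced word \<open>ws\<close>, which therefore has length
    one.\<close>
  have parity: "even (count_list (reflections W ws) r) \<longleftrightarrow> even (count_list [t] r)" for r
    using even_count_reflections[of ws "[t]"] ws assms by auto
  have "r \<in> set (reflections W ws) \<longleftrightarrow> r = t" for r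
    using parity[of r] unfolding count_list_distinct[OF ws(3)]
    by (cases "r = t") (auto split: if_splits)
  then have "set (reflections W ws) = {t}" by blast
  then have "length ws = 1"
    using distinct_card[OF ws(3)] by simp
  then obtain k where "ws = [k]" by (auto simp: length_Suc_conv)
  then show ?thesis using ws assms by auto
qed

text \<open>
  Among the reflections of the word \<open>t w t\<close> the generator \<open>t\<close> occurs first, and it does not lie
  in \<open>W\<^sub>K\<close>; since \<open>t w t \<in> W\<^sub>K\<close>, it must occur a second time, and that can only be as the last
  reflection \<open>(t w) t (t w)\<^sup>-\<^sup>1\<close>.
\<close>

lemma conj_parabolic_imp_commute:
  assumes "K \<subseteq> S" "t \<in> S" "t \<notin> K" "w \<in> generate W K" "t \<otimes> w \<otimes> t \<in> generate W K"
  shows "t \<otimes> w = w \<otimes> t"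
proof -
  obtain ws vs where ws: "set ws \<subseteq> K" "word_prod W ws = w"
    and vs: "set vs \<subseteq> K" "word_prod W vs = t \<otimes> w \<otimes> t"
    using assms generate_iff_word by metis
  have w: "w \<in> carrier W" and wsS: "set ws \<subseteq> S" and vsS: "set vs \<subseteq> S"
    using assms ws vs parabolic_closed by auto
  have nt: "t \<notin> generate W K" using assms gen_in_parabolic by blast
  \<comment> \<open>Middle entries are conjugates by \<open>t\<close> of elements of
    \<open>W\<^sub>K\<close>; one of them equals \<open>t\<close> only if \<open>t\<close> itself
    lies in \<open>W\<^sub>K\<close>.\<close>
  have inner: "t \<notin> set (map (\<lambda>r. t \<otimes> r \<otimes> inv t) (reflections W ws))"
  proof
    assume "t \<in> set (map (\<lambda>r. t \<otimes> r \<otimes> inv t) (reflections W ws))"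
    then obtain r where r: "r \<in> set (reflections W ws)" "t = t \<otimes> r \<otimes> inv t" by auto
    then have rK: "r \<in> generate W K" using reflections_parabolic[OF assms(1) ws(1)] by auto
    have "t \<otimes> t \<otimes> inv t = t" using assms by (simp add: m_assoc)
    with r have "r = t"
      using conj_cancel[of t r t] parabolic_closed[OF assms(1) rK] assms by auto
    with rK nt show False by simp
  qed
  have split: "reflections W (t # ws @ [t]) =
      t # map (\<lambda>r. t \<otimes> r \<otimes> inv t) (reflections W ws) @ [t \<otimes> (w \<otimes> t \<otimes> inv w) \<otimes> inv t]"
    using ws wsS assms by (simp add: reflections_append word_carrier)
  have "word_prod W (t # ws @ [t]) = word_prod W vs"
    using ws vs wsS w assms by (simp add: word_prod_append word_carrier m_assoc)
  then have "even (count_list (reflections W (t # ws @ [t])) t) \<longleftrightarrow>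
      even (count_list (reflections W vs) t)"
    using wsS vsS assms by (intro even_count_reflections) auto
  moreover have "t \<notin> set (reflections W vs)"
    using reflections_parabolic[OF assms(1) vs(1)] nt by auto
  ultimately have "even (count_list (reflections W (t # ws @ [t])) t)"
    by (simp add: count_list_0_iff)
  then have "t = t \<otimes> (w \<otimes> t \<otimes> inv w) \<otimes> inv t"
    using inner unfolding split
    by (auto simp: count_list_0_iff split: if_splits simp del: set_map list.set_map)
  moreover have "t = t \<otimes> t \<otimes> inv t" using assms by (simp add: m_assoc)
  ultimately have "t = w \<otimes> t \<otimes> inv w"
    using conj_cancel[of t t "w \<otimes> t \<otimes> inv w"] w assms by auto
  then show ?thesis
    using w assms by (metis gen_carrier inv_solve_right m_closed)
qed

text \<open>
  The first letter \<open>k\<close> of a reduced word for \<open>w\<close> is one of its reflections, and \<open>t k t\<close> is then a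
  reflection of \<open>t w t\<close>, so that the commutation lemma applies to \<open>k\<close> as well.
\<close>

lemma conj_parabolic_imp_centralizer:
  assumes "K \<subseteq> S" "t \<in> S" "t \<notin> K" "w \<in> generate W K" "t \<otimes> w \<otimes> t \<in> generate W K"
  shows "w \<in> generate W {k \<in> K. t \<otimes> k = k \<otimes> t}"
proof -
  have "word_prod W ws \<in> generate W {k \<in> K. t \<otimes> k = k \<otimes> t}"
    if "set ws \<subseteq> K" "t \<otimes> word_prod W ws \<otimes> t \<in> generate W K" for ws
    using that
  proof (induction ws rule: length_induct)
    case (1 ws)
    \<comment> \<open>A reduced word no longer than \<open>ws\<close> keeps its tail within reach of
      the induction hypothesis.\<close>
    obtain us where us: "set us \<subseteq> K" "length us \<le> length ws"
      "word_prod W us = word_prod W ws" "distinct (reflections W us)"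
      using reduced_word[OF assms(1) 1(2)] by blast
    show ?case
    proof (cases us)
      case Nil
      then show ?thesis using us by (auto intro: generate.one simp flip: us(3))
    next
      case (Cons k xs)
      have kK: "k \<in> K" and kS: "k \<in> S" and xsK: "set xs \<subseteq> K" and xsS: "set xs \<subseteq> S"
        and usS: "set us \<subseteq> S"
        using us Cons assms by auto
      let ?w = "word_prod W us"
      have w: "?w \<in> carrier W" using usS by (simp add: word_carrier)
      have wK: "?w \<in> generate W K" using us(1) assms generate_iff_word by blast
      have twt: "t \<otimes> ?w \<otimes> t \<in> generate W K" using us 1 by simp
      have comm: "t \<otimes> ?w = ?w \<otimes> t"
        using conj_parabolic_imp_commute[OF assms(1-3) wK twt] .
      obtain vs where vs: "set vs \<subseteq> K" "word_prod W vs = t \<otimes> ?w \<otimes> t"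
        using twt assms generate_iff_word by metis
      have vsS: "set vs \<subseteq> S" using vs assms by auto
      have last: "t \<otimes> (?w \<otimes> t \<otimes> inv ?w) \<otimes> inv t = t"
        using w assms by (simp add: m_assoc flip: comm)
      have split: "reflections W (t # us @ [t]) =
          t # map (\<lambda>r. t \<otimes> r \<otimes> inv t) (reflections W us) @ [t]"
        using usS assms last by (simp add: reflections_append word_carrier)
      \<comment> \<open>The two outer entries \<open>t\<close> must not disturb the count of
        \<open>t k t\<close>.\<close>
      have neq: "t \<otimes> k \<otimes> inv t \<noteq> t"
      proof
        assume "t \<otimes> k \<otimes> inv t = t"
        moreover have "t \<otimes> t \<otimes> inv t = t" using assms by (simp add: m_assoc)
        ultimately have "k = t" using conj_cancel[of t k t] kS assms by auto
        then show False using kK assms by simp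
      qed
      have "inj_on (\<lambda>r. t \<otimes> r \<otimes> inv t) (set (reflections W us))"
        using assms reflections_closed[of us] usS word_carrier
        by (intro inj_onI) (auto simp: subset_iff)
      then have "distinct (map (\<lambda>r. t \<otimes> r \<otimes> inv t) (reflections W us))"
        using us by (simp add: distinct_map)
      moreover have "t \<otimes> k \<otimes> inv t \<in> set (map (\<lambda>r. t \<otimes> r \<otimes> inv t) (reflections W us))"
        using Cons by simp
      ultimately have "count_list (map (\<lambda>r. t \<otimes> r \<otimes> inv t) (reflections W us)) (t \<otimes> k \<otimes> inv t) = 1"
        by (simp only: count_list_distinct if_True)
      then have "odd (count_list (reflections W (t # us @ [t])) (t \<otimes> k \<otimes> inv t))"
        using neq unfolding split by (simp del: inv_gen)
      moreover have "word_prod W (t # us @ [t]) = word_prod W vs"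
        using vs usS w assms by (simp add: word_prod_append word_carrier m_assoc)
      ultimately have "odd (count_list (reflections W vs) (t \<otimes> k \<otimes> inv t))"
        using even_count_reflections[of "t # us @ [t]" vs] usS vsS assms by auto
      then have "t \<otimes> k \<otimes> inv t \<in> set (reflections W vs)"
        by (metis count_list_0_iff even_zero)
      then have tkt: "t \<otimes> k \<otimes> t \<in> generate W K"
        using reflections_parabolic[OF assms(1) vs(1)] assms by auto
      have kc: "t \<otimes> k = k \<otimes> t"
        using conj_parabolic_imp_commute[OF assms(1-3) _ tkt] kK by (blast intro: generate.incl)
      let ?x = "word_prod W xs"
      have x: "?x \<in> carrier W" using xsS by (simp add: word_carrier)
      \<comment> \<open>Since \<open>?w\<close> is \<open>k\<close> times \<open>?x\<close>, first
        \<open>t t\<close> and then \<open>k k\<close> cancel on the right.\<close>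
      have "t \<otimes> ?x \<otimes> t = (t \<otimes> k \<otimes> t) \<otimes> (t \<otimes> ?w \<otimes> t)"
        using x assms kS Cons by (simp add: m_assoc)
      then have "t \<otimes> ?x \<otimes> t \<in> generate W K"
        using tkt twt by (simp add: generate.eng)
      then have "?x \<in> generate W {k \<in> K. t \<otimes> k = k \<otimes> t}"
        using 1 xsK us Cons by auto
      then have "k \<otimes> ?x \<in> generate W {k \<in> K. t \<otimes> k = k \<otimes> t}"
        using kK kc by (auto intro: generate.intros)
      then show ?thesis using us Cons by simp
    qed
  qed
  moreover obtain ws where "set ws \<subseteq> K" "word_prod W ws = w"
    using assms generate_iff_word by metis
  ultimately show ?thesis using assms by blast
qed

section \<open>Lengths and diagram edges\<close>

lemma word_exists:
  assumes "w \<in> carrier W"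
  shows "\<exists>ws. set ws \<subseteq> S \<and> word_prod W ws = w"
  using assms generate_iff_word[of S w] generates by simp

lemma cox_length_word:
  assumes "w \<in> carrier W"
  shows "\<exists>ws. set ws \<subseteq> S \<and> length ws = cox_length W S w \<and> word_prod W ws = w"
  unfolding cox_length_def
  by (rule LeastI_ex) (use word_exists[OF assms] in auto)

text \<open>All words for an element have the same length parity, and one more letter flips it. So a
  product that is not shorter is strictly longer.\<close>

lemma cox_length_gen_mult:
  assumes "s \<in> S" "w \<in> carrier W"
  shows "cox_length W S (s \<otimes> w) \<noteq> cox_length W S w"
proof
  assume eq: "cox_length W S (s \<otimes> w) = cox_length W S w"
  obtain us vs where "set us \<subseteq> S" "length us = cox_length W S w" "word_prod W us = w"
    "set vs \<subseteq> S" "length vs = cox_length W S (s \<otimes> w)" "word_prod W vs = s \<otimes> w"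
    using cox_length_word assms by (metis gen_carrier m_closed)
  then show False
    using even_length_word[of "s # us" vs] eq assms by simp
qed

text \<open>This is what rules out diagram edges between commuting generators.\<close>

lemma ord_commuting_gens:
  assumes "s \<in> S" "t \<in> S" "s \<noteq> t" "s \<otimes> t = t \<otimes> s"
  shows "ord (s \<otimes> t) = 2"
proof -
  have "s \<otimes> t \<noteq> \<one>"
    using assms by (metis gen_carrier inv_equality inv_gen)
  moreover have "(s \<otimes> t) [^] (2::nat) = \<one>"
  proof -
    have "(s \<otimes> t) [^] (2::nat) = (s \<otimes> t) \<otimes> (t \<otimes> s)"
      using assms by (simp add: numeral_2_eq_2)
    then show ?thesis using assms(1,2) by (simp add: m_assoc gen_square)
  qed
  moreover have "s \<otimes> t \<in> carrier W" using assms by simp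
  ultimately have "ord (s \<otimes> t) dvd 2" "ord (s \<otimes> t) \<noteq> 1"
    using pow_eq_id ord_eq_1 by auto
  then show ?thesis using two_is_prime_nat prime_nat_iff by blast
qed

end

section \<open>Codistances and residues\<close>

context twin_building
begin

text \<open>Moving from \<open>D\<close> to \<open>C\<close> turns the distance to \<open>C\<close>
  into the identity. By \<open>WD2\<close> this changes it by \<open>s\<close> or not at all, and
  the latter would give \<open>C = D\<close>.\<close>

lemma dist_sym_gen:
  assumes "C \<in> Ch \<epsilon>" "D \<in> Ch \<epsilon>" "s \<in> S" "\<delta> \<epsilon> C D = s"
  shows "\<delta> \<epsilon> D C = s"
proof -
  interpret building W S "Ch \<epsilon>" "\<delta> \<epsilon>" by (rule halves)
  have d: "\<delta> \<epsilon> D C \<in> carrier W" "\<delta> \<epsilon> C C = \<one>" "C \<noteq> D"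
    using assms dist_closed WD1[of C C] WD1[of C D] gen_neq_one[of s] by auto
  then have "\<delta> \<epsilon> D C \<noteq> \<one>" using assms WD1[of D C] by auto
  moreover have "\<one> \<in> {s \<otimes> \<delta> \<epsilon> D C, \<delta> \<epsilon> D C}"
    using WD2[OF assms(2,1,1,3,4)] d(2) by simp
  ultimately have "s \<otimes> \<delta> \<epsilon> D C = \<one>" by auto
  then show ?thesis using d assms
    by (metis gen_cancel gen_carrier r_one)
qed

text \<open>If \<open>s\<close> shortens the codistance, \<open>Tw2\<close> decides. Otherwise
  \<open>Tw3\<close> gives a chamber \<open>E\<close> of the same panel with the longer codistance,
  and any other chamber of the panel is reached from \<open>E\<close> by a shortening step.\<close>

lemma codist_adjacent_left:
  assumes "C \<in> Ch \<epsilon>" "C' \<in> Ch \<epsilon>" "D \<in> Ch (\<not> \<epsilon>)" "s \<in> S" "\<delta> \<epsilon> C' C = s"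
  shows "\<delta>s C' D \<in> {\<delta>s C D, s \<otimes> \<delta>s C D}"
proof -
  interpret building W S "Ch \<epsilon>" "\<delta> \<epsilon>" by (rule halves)
  let ?w = "\<delta>s C D"
  have w: "?w \<in> carrier W" using assms codist_closed by auto
  show ?thesis
  proof (cases "cox_length W S (s \<otimes> ?w) < cox_length W S ?w")
    case True
    then show ?thesis using Tw2[of C \<epsilon> D C' s] assms by simp
  next
    case False
    obtain E where E: "E \<in> Ch \<epsilon>" "\<delta> \<epsilon> E C = s" "\<delta>s E D = s \<otimes> ?w"
      using Tw3 assms by blast
    have CE: "\<delta> \<epsilon> C E = s" using dist_sym_gen[of E \<epsilon> C s] E assms by simp
    then have "\<delta> \<epsilon> C' E \<in> {\<one>, s}"
      using WD2[of C E C' s] E assms gen_square by auto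
    then show ?thesis
    proof
      assume "\<delta> \<epsilon> C' E = \<one>"
      then have "C' = E" using WD1 E assms by simp
      then show ?thesis using E by simp
    next
      assume "\<delta> \<epsilon> C' E \<in> {s}"
      moreover have "cox_length W S (s \<otimes> \<delta>s E D) < cox_length W S (\<delta>s E D)"
        using False cox_length_gen_mult[of s ?w] w assms E by simp
      ultimately have "\<delta>s C' D = s \<otimes> \<delta>s E D"
        using Tw2[of E \<epsilon> D C' s] E assms by simp
      then show ?thesis using E w assms by simp
    qed
  qed
qed

lemma codist_adjacent_right:
  assumes "C \<in> Ch \<epsilon>" "D \<in> Ch (\<not> \<epsilon>)" "D' \<in> Ch (\<not> \<epsilon>)" "s \<in> S" "\<delta> (\<not> \<epsilon>) D' D = s"
  shows "\<delta>s C D' \<in> {\<delta>s C D, \<delta>s C D \<otimes> s}"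
proof -
  have c: "\<delta>s D C \<in> carrier W" using assms codist_closed[of D "\<not> \<epsilon>" C] by simp
  have "\<delta>s D' C \<in> {\<delta>s D C, s \<otimes> \<delta>s D C}"
    using codist_adjacent_left[of D "\<not> \<epsilon>" D' C s] assms by simp
  then show ?thesis
    using Tw1[of C \<epsilon> D] Tw1[of C \<epsilon> D'] assms c by (auto simp: inv_mult_group)
qed

text \<open>Along a gallery from \<open>D\<close> to \<open>D'\<close> whose types spell a word in
  \<open>L\<close>, each step multiplies the codistance on the right by a letter of \<open>L\<close>
  or leaves it alone.\<close>

lemma codist_residue:
  assumes "L \<subseteq> S" "C \<in> Ch \<epsilon>" "D \<in> Ch (\<not> \<epsilon>)" "D' \<in> Ch (\<not> \<epsilon>)" "\<delta> (\<not> \<epsilon>) D D' \<in> generate W L"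
  shows "\<delta>s C D \<in> generate W L \<longleftrightarrow> \<delta>s C D' \<in> generate W L"
proof -
  interpret building W S "Ch (\<not> \<epsilon>)" "\<delta> (\<not> \<epsilon>)" by (rule halves)
  obtain ws where "set ws \<subseteq> L" "word_prod W ws = \<delta> (\<not> \<epsilon>) D D'"
    using assms generate_iff_word by metis
  then show ?thesis using assms(3)
  proof (induction ws arbitrary: D)
    case Nil
    then show ?case using WD1 assms by auto
  next
    case (Cons k ws)
    have k: "k \<in> L" "k \<in> S" "k \<in> generate W L"
      using Cons assms by (auto intro: generate.incl)
    obtain E where E: "E \<in> Ch (\<not> \<epsilon>)" "\<delta> (\<not> \<epsilon>) E D = k"
      "\<delta> (\<not> \<epsilon>) E D' = k \<otimes> \<delta> (\<not> \<epsilon>) D D'"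
      using WD3 Cons assms k by blast
    have "set ws \<subseteq> S" using Cons.prems assms by auto
    then have "\<delta> (\<not> \<epsilon>) E D' = word_prod W ws"
      using E k Cons.prems(2)[symmetric] by (simp add: word_carrier)
    then have IH: "\<delta>s C E \<in> generate W L \<longleftrightarrow> \<delta>s C D' \<in> generate W L"
      using Cons E by auto
    have c: "\<delta>s C D \<in> carrier W" using codist_closed Cons.prems assms by blast
    have "\<delta>s C E \<in> {\<delta>s C D, \<delta>s C D \<otimes> k}"
      using codist_adjacent_right[of C \<epsilon> D E k] E k Cons.prems assms by simp
    moreover have "\<delta>s C D \<otimes> k \<in> generate W L \<longleftrightarrow> \<delta>s C D \<in> generate W L"
    proof
      assume "\<delta>s C D \<otimes> k \<in> generate W L"
      then have "\<delta>s C D \<otimes> k \<otimes> k \<in> generate W L" using k by (simp add: generate.eng)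
      then show "\<delta>s C D \<in> generate W L" using c k by (simp add: m_assoc gen_square)
    qed (use k in \<open>simp add: generate.eng\<close>)
    ultimately show ?case using IH by auto
  qed
qed

section \<open>Images of residues under opposite maps\<close>

lemma half_unique: "C \<in> Ch \<epsilon> \<Longrightarrow> C \<in> Ch \<eta> \<Longrightarrow> \<epsilon> = \<eta>"
  using disjoint by (cases \<epsilon>; cases \<eta>) auto

lemma in_twin_chambers: "C \<in> twin_chambers Ch \<longleftrightarrow> (\<exists>\<epsilon>. C \<in> Ch \<epsilon>)"
  unfolding twin_chambers_def by (metis (full_types) Un_iff)

lemma residue_of:
  assumes "K \<subseteq> S" "C \<in> Ch \<epsilon>"
  shows "is_residue W S Ch \<delta> K \<epsilon> {D \<in> Ch \<epsilon>. \<delta> \<epsilon> C D \<in> generate W K}"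
    and "C \<in> {D \<in> Ch \<epsilon>. \<delta> \<epsilon> C D \<in> generate W K}"
proof -
  interpret building W S "Ch \<epsilon>" "\<delta> \<epsilon>" by (rule halves)
  show "is_residue W S Ch \<delta> K \<epsilon> {D \<in> Ch \<epsilon>. \<delta> \<epsilon> C D \<in> generate W K}"
    using assms unfolding is_residue_def by blast
  show "C \<in> {D \<in> Ch \<epsilon>. \<delta> \<epsilon> C D \<in> generate W K}"
    using assms WD1[of C C] by (auto intro: generate.one)
qed

text \<open>Disjointness of the halves identifies the sign hidden in
  \<open>opposite_residues\<close>. The type \<open>L\<close> of the image stays unknown, as
  \<open>\<theta>\<close> may not respect types.\<close>

lemma opposite_residue_image:
  assumes "J_opposite W S Ch \<delta> \<delta>s J \<theta>" "C \<in> Ch \<epsilon>"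
    and R: "R = {D \<in> Ch \<epsilon>. \<delta> \<epsilon> C D \<in> generate W (S - J)}"
  obtains L E where "L \<subseteq> S" "E \<in> Ch (\<not> \<epsilon>)"
    "\<theta> ` R = {D \<in> Ch (\<not> \<epsilon>). \<delta> (\<not> \<epsilon>) E D \<in> generate W L}"
    "\<And>B. B \<in> R \<Longrightarrow> \<exists>D\<in>\<theta> ` R. \<delta>s B D = \<one>"
proof -
  have res: "is_residue W S Ch \<delta> (S - J) \<epsilon> R" "C \<in> R"
    using residue_of[of "S - J" C \<epsilon>] assms by auto
  then have opp: "opposite_residues W S Ch \<delta> \<delta>s R (\<theta> ` R)"
    using assms(1) unfolding J_opposite_def by blast
  then obtain \<eta> K L where KL: "is_residue W S Ch \<delta> K \<eta> R" "is_residue W S Ch \<delta> L (\<not> \<eta>) (\<theta> ` R)"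
    unfolding opposite_residues_def by blast
  have "C \<in> Ch \<eta>" using KL(1) res(2) unfolding is_residue_def by auto
  then have "\<eta> = \<epsilon>" using half_unique assms(2) by blast
  with KL(2) obtain E where "L \<subseteq> S" "E \<in> Ch (\<not> \<epsilon>)"
    "\<theta> ` R = {D \<in> Ch (\<not> \<epsilon>). \<delta> (\<not> \<epsilon>) E D \<in> generate W L}"
    unfolding is_residue_def by auto
  moreover have "\<exists>D\<in>\<theta> ` R. \<delta>s B D = \<one>" if "B \<in> R" for B
    using opp that unfolding opposite_residues_def opposite_def by blast
  ultimately show ?thesis using that by blast
qed

text \<open>The chamber lies in an \<open>S - J\<close>-residue whose image is a residue of the
  other half.\<close>

lemma J_opposite_swaps_halves:
  assumes "J_opposite W S Ch \<delta> \<delta>s J \<theta>" "C \<in> Ch \<epsilon>"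
  shows "\<theta> C \<in> Ch (\<not> \<epsilon>)"
proof -
  let ?R = "{D \<in> Ch \<epsilon>. \<delta> \<epsilon> C D \<in> generate W (S - J)}"
  obtain L E where "\<theta> ` ?R = {D \<in> Ch (\<not> \<epsilon>). \<delta> (\<not> \<epsilon>) E D \<in> generate W L}"
    by (rule opposite_residue_image[OF assms HOL.refl]) blast
  moreover have "C \<in> ?R" using residue_of(2)[of "S - J" C \<epsilon>] assms by auto
  ultimately show ?thesis by blast
qed

text \<open>
  Opposition forces the type \<open>L\<close> of the image of an \<open>S - {s}\<close>-residue to contain \<open>S - {s}\<close>. If it
  were all of \<open>S\<close>, the image would be a whole half, contradicting injectivity.
\<close>

lemma singleton_opposite_codist:
  assumes inj: "inj_on \<theta> (twin_chambers Ch)" and "s \<in> S"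
    and J: "J_opposite W S Ch \<delta> \<delta>s {s} \<theta>" and C: "C \<in> Ch \<epsilon>"
  shows "\<delta>s C (\<theta> C) \<in> generate W (S - {s})"
proof -
  interpret building W S "Ch \<epsilon>" "\<delta> \<epsilon>" by (rule halves)
  interpret opp: building W S "Ch (\<not> \<epsilon>)" "\<delta> (\<not> \<epsilon>)" by (rule halves)
  define R where "R = {D \<in> Ch \<epsilon>. \<delta> \<epsilon> C D \<in> generate W (S - {s})}"
  obtain L E where L: "L \<subseteq> S" and E: "E \<in> Ch (\<not> \<epsilon>)"
    and im: "\<theta> ` R = {D \<in> Ch (\<not> \<epsilon>). \<delta> (\<not> \<epsilon>) E D \<in> generate W L}"
    and op: "\<And>B. B \<in> R \<Longrightarrow> \<exists>D\<in>\<theta> ` R. \<delta>s B D = \<one>"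
    by (rule opposite_residue_image[OF J C R_def]) blast
  have CR: "C \<in> R" using residue_of(2)[of "S - {s}" C \<epsilon>] C by (auto simp: R_def)
  \<comment> \<open>Some chamber of the image is opposite \<open>B\<close>; as the image is an
    \<open>L\<close>-residue, \<open>codist_residue\<close> spreads membership to all of it.\<close>
  have inL: "\<delta>s B D \<in> generate W L" if B: "B \<in> R" and D: "D \<in> \<theta> ` R" for B D
  proof -
    obtain D0 where D0: "D0 \<in> \<theta> ` R" "\<delta>s B D0 = \<one>" using op[OF B] by blast
    have B': "B \<in> Ch \<epsilon>" using B by (auto simp: R_def)
    have "\<delta>s B E \<in> generate W L"
      using codist_residue[OF L B' E, of D0] D0 im by (auto intro: generate.one)
    then show ?thesis using codist_residue[OF L B' E, of D] D im by auto
  qed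
  \<comment> \<open>Starting from a chamber \<open>D\<close> opposite \<open>C\<close>,
    \<open>Tw3\<close> gives a \<open>k\<close>-neighbour of \<open>C\<close>, still in
    \<open>R\<close>, with codistance \<open>k\<close> to \<open>D\<close>.\<close>
  have "k \<in> L" if k: "k \<in> S" "k \<noteq> s" for k
  proof -
    obtain D where D: "D \<in> \<theta> ` R" "\<delta>s C D = \<one>" using op[OF CR] by blast
    have "D \<in> Ch (\<not> \<epsilon>)" using D im by auto
    then obtain C' where C': "C' \<in> Ch \<epsilon>" "\<delta> \<epsilon> C' C = k" "\<delta>s C' D = k"
      using Tw3[OF C _ k(1), of D] D k by auto
    then have "\<delta> \<epsilon> C C' = k" using dist_sym_gen C k by blast
    then have "C' \<in> R" using C' k by (auto simp: R_def intro: generate.incl)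
    then have "k \<in> generate W L" using inL[of C' D] D C' by simp
    then show ?thesis using gen_in_parabolic[OF L k(1)] by simp
  qed
  then have KL: "S - {s} \<subseteq> L" by auto
  have "s \<notin> L"
  proof
    assume "s \<in> L"
    then have "L = S" using KL L by auto
    then have full: "\<theta> ` R = Ch (\<not> \<epsilon>)"
      using im generates opp.dist_closed E by auto
    obtain C' where C': "C' \<in> Ch \<epsilon>" "\<delta> \<epsilon> C' C = s" using WD3[OF C C assms(2)] by blast
    then have "\<delta> \<epsilon> C C' = s" using dist_sym_gen C assms by blast
    then have nR: "C' \<notin> R"
      using gen_in_parabolic[of "S - {s}" s] assms(2) by (auto simp: R_def)
    have "\<theta> C' \<in> \<theta> ` R" using J_opposite_swaps_halves[OF J C'(1)] full by simp
    then have "C' \<in> R"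
      using inj_on_image_mem_iff[OF inj, of C' R] C'(1) in_twin_chambers by (auto simp: R_def)
    with nR show False by simp
  qed
  then have "L = S - {s}" using KL L by auto
  then show ?thesis using inL CR by auto
qed

text \<open>The type \<open>u\<close> of the adjacency between \<open>\<theta> C'\<close> and
  \<open>\<theta> C\<close> is at first only known to lie in \<open>S\<close>; forcing
  \<open>u = t\<close> makes the centralizer lemma applicable.\<close>

lemma codist_descent:
  assumes adj: "\<And>C D. C \<in> twin_chambers Ch \<Longrightarrow> D \<in> twin_chambers Ch \<Longrightarrow>
      adjacent S Ch \<delta> C D \<Longrightarrow> adjacent S Ch \<delta> (\<theta> C) (\<theta> D)"
    and swap: "\<And>\<epsilon> C. C \<in> Ch \<epsilon> \<Longrightarrow> \<theta> C \<in> Ch (\<not> \<epsilon>)"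
    and K: "K \<subseteq> S" "\<And>\<epsilon> C. C \<in> Ch \<epsilon> \<Longrightarrow> \<delta>s C (\<theta> C) \<in> generate W K"
    and t: "t \<in> S" "t \<notin> K" and C: "C \<in> Ch \<epsilon>"
  shows "\<delta>s C (\<theta> C) \<in> generate W {k \<in> K. t \<otimes> k = k \<otimes> t}"
proof -
  let ?w = "\<delta>s C (\<theta> C)"
  have wK: "?w \<in> generate W K" using K C by blast
  then have w: "?w \<in> carrier W" using parabolic_closed K by blast
  have invK: "inv ?w \<in> generate W K"
    using subgroup.m_inv_closed[OF subgroup_parabolic[OF K(1)] wK] .
  obtain C' where C': "C' \<in> Ch \<epsilon>" "\<delta> \<epsilon> C' C = t" "\<delta>s C' (\<theta> C) = t \<otimes> ?w"
    using Tw3[OF C swap[OF C] t(1)] by blast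
  have "adjacent S Ch \<delta> C' C" using C' C t unfolding adjacent_def by auto
  then have "adjacent S Ch \<delta> (\<theta> C') (\<theta> C)" using adj C C' in_twin_chambers by blast
  then obtain \<eta> where \<eta>: "\<theta> C \<in> Ch \<eta>" "\<delta> \<eta> (\<theta> C') (\<theta> C) \<in> S"
    unfolding adjacent_def by blast
  then have "\<eta> = (\<not> \<epsilon>)" using half_unique swap C by blast
  then obtain u where u: "u \<in> S" "\<delta> (\<not> \<epsilon>) (\<theta> C') (\<theta> C) = u" using \<eta> by auto
  have w': "\<delta>s C' (\<theta> C') \<in> generate W K" using K C' by blast
  have "\<delta>s C' (\<theta> C') \<in> {t \<otimes> ?w, t \<otimes> ?w \<otimes> u}"
    using codist_adjacent_right[OF C'(1) swap[OF C] swap[OF C'(1)] u] C' by simp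
  moreover have "t \<otimes> ?w \<notin> generate W K"
  proof
    assume "t \<otimes> ?w \<in> generate W K"
    then have "t \<otimes> ?w \<otimes> inv ?w \<in> generate W K" using invK by (simp add: generate.eng)
    then have "t \<in> generate W K" using w t by (simp add: m_assoc)
    then show False using gen_in_parabolic[OF K(1)] t by blast
  qed
  ultimately have twu: "t \<otimes> ?w \<otimes> u \<in> generate W K" using w' by auto
  \<comment> \<open>Cancelling \<open>u\<close> and \<open>?w\<close> puts \<open>t\<close> in the
    parabolic subgroup of \<open>insert u K\<close>, so \<open>t\<close> is one of these
    generators.\<close>
  have "t = u"
  proof -
    have sub: "generate W K \<subseteq> generate W (insert u K)"
      by (rule mono_generate) auto
    have "u \<in> generate W (insert u K)" by (simp add: generate.incl)
    then have "t \<otimes> ?w \<otimes> u \<otimes> u \<otimes> inv ?w \<in> generate W (insert u K)"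
      using subsetD[OF sub twu] subsetD[OF sub invK] by (simp add: generate.eng)
    moreover have "t \<otimes> ?w \<otimes> u \<otimes> u \<otimes> inv ?w = t"
      using w t u by (simp add: m_assoc)
    ultimately have "t \<in> insert u K"
      using gen_in_parabolic[of "insert u K" t] K u t by auto
    then show ?thesis using t by auto
  qed
  then show ?thesis
    using conj_parabolic_imp_centralizer[OF K(1) t wK] twu by simp
qed

lemma residue_empty:
  assumes "is_residue W S Ch \<delta> {} \<epsilon> R"
  obtains C where "C \<in> Ch \<epsilon>" "R = {C}"
proof -
  interpret building W S "Ch \<epsilon>" "\<delta> \<epsilon>" by (rule halves)
  show ?thesis using assms that WD1 unfolding is_residue_def
    by (auto simp: generate_empty)
qed

lemma singleton_residue:
  assumes "C \<in> Ch \<epsilon>"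
  shows "is_residue W S Ch \<delta> {} \<epsilon> {C}"
proof -
  interpret building W S "Ch \<epsilon>" "\<delta> \<epsilon>" by (rule halves)
  show ?thesis using assms WD1 unfolding is_residue_def
    by (auto simp: generate_empty)
qed

end

theorem lemma4p3:
  fixes W :: "('w, 'x) monoid_scheme" and S :: "'w set"
    and Ch :: "bool \<Rightarrow> 'c set" and \<delta> :: "bool \<Rightarrow> 'c \<Rightarrow> 'c \<Rightarrow> 'w" and \<delta>s :: "'c \<Rightarrow> 'c \<Rightarrow> 'w"
    and \<theta> :: "'c \<Rightarrow> 'c" and s :: 'w
  assumes "finite S"
    and "irreducible_coxeter W S"
    and "twin_building W S Ch \<delta> \<delta>s"
    and "twin_automorphism W S Ch \<delta> \<delta>s \<theta>"
    and "s \<in> S"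
    and "J_opposite W S Ch \<delta> \<delta>s {s} \<theta>"
  shows "J_opposite W S Ch \<delta> \<delta>s S \<theta> \<and>
    (\<forall>C\<in>twin_chambers Ch. opposite W Ch \<delta>s C (\<theta> C))"
proof -
  interpret twin_building W S Ch \<delta> \<delta>s by fact
  have inj: "inj_on \<theta> (twin_chambers Ch)"
    and adj: "\<And>C D. C \<in> twin_chambers Ch \<Longrightarrow> D \<in> twin_chambers Ch \<Longrightarrow>
      adjacent S Ch \<delta> C D \<Longrightarrow> adjacent S Ch \<delta> (\<theta> C) (\<theta> D)"
    using assms(4) by (auto simp: twin_automorphism_def bij_betw_def)
  have swap: "\<theta> C \<in> Ch (\<not> \<epsilon>)" if "C \<in> Ch \<epsilon>" for C \<epsilon>
    using J_opposite_swaps_halves[OF assms(6) that] .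
  \<comment> \<open>Keeping \<open>s\<close> out of \<open>K\<close> provides a starting point
    outside \<open>K\<close> for paths in the diagram.\<close>
  define P where "P K \<longleftrightarrow> K \<subseteq> S - {s} \<and> (\<forall>\<epsilon>. \<forall>C\<in>Ch \<epsilon>. \<delta>s C (\<theta> C) \<in> generate W K)" for K
  have "P (S - {s})"
    using singleton_opposite_codist[OF inj assms(5,6)] by (simp add: P_def)
  then obtain K where K: "P K" and least: "\<And>K'. P K' \<Longrightarrow> card K \<le> card K'"
    using ex_has_least_nat[of P _ card] by blast
  have finK: "finite K" using K assms(1) by (auto simp: P_def intro: finite_subset)
  have KS: "K \<subseteq> S" using K by (auto simp: P_def)
  have commute: "t \<otimes>\<^bsub>W\<^esub> k = k \<otimes>\<^bsub>W\<^esub> t" if "t \<in> S" "t \<notin> K" "k \<in> K" for t k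
  proof -
    define K' where "K' = {k \<in> K. t \<otimes>\<^bsub>W\<^esub> k = k \<otimes>\<^bsub>W\<^esub> t}"
    have codistK: "\<delta>s C (\<theta> C) \<in> generate W K" if "C \<in> Ch \<epsilon>" for C \<epsilon>
      using K that unfolding P_def by blast
    have "\<delta>s C (\<theta> C) \<in> generate W K'" if "C \<in> Ch \<epsilon>" for C \<epsilon>
      unfolding K'_def
      by (rule codist_descent[OF adj swap KS codistK \<open>t \<in> S\<close> \<open>t \<notin> K\<close> that])
    moreover have sub: "K' \<subseteq> K" by (auto simp: K'_def)
    ultimately have "P K'" using K unfolding P_def by blast
    \<comment> \<open>By minimality \<open>K'\<close> cannot be smaller, so all of \<open>K\<close>
      commutes with \<open>t\<close>.\<close>
    then have "K' = K" by (intro card_seteq finK sub least)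
    then show ?thesis using that unfolding K'_def by blast
  qed
  have "K = {}"
  proof (rule ccontr)
    assume "K \<noteq> {}"
    then obtain k where k: "k \<in> K" by blast
    \<comment> \<open>No diagram edge enters \<open>K\<close> from outside, since it would join
      commuting generators.\<close>
    have "x \<notin> K" if "(s, x) \<in> (coxeter_diagram W S)\<^sup>*" for x
      using that
    proof (induction rule: rtrancl_induct)
      case base
      then show ?case using K by (auto simp: P_def)
    next
      case (step x y)
      then show ?case
        using commute[of x y] ord_commuting_gens[of x y] by (auto simp: coxeter_diagram_def)
    qed
    moreover have "(s, k) \<in> (coxeter_diagram W S)\<^sup>*"
      using assms(2,5) k KS unfolding irreducible_coxeter_def by blast
    ultimately show False using k by blast
  qed
  then have one: "\<delta>s C (\<theta> C) = \<one>\<^bsub>W\<^esub>" if "C \<in> Ch \<epsilon>" for C \<epsilon>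
    using K that by (auto simp: P_def generate_empty)
  have opp: "opposite W Ch \<delta>s C (\<theta> C)" if "C \<in> Ch \<epsilon>" for C \<epsilon>
    using one[OF that] swap[OF that] that unfolding opposite_def by blast
  \<comment> \<open>\<open>S\<close>-opposition concerns residues of type \<open>S - S\<close>, that
    is, single chambers.\<close>
  have "opposite_residues W S Ch \<delta> \<delta>s R (\<theta> ` R)" if R: "is_residue W S Ch \<delta> {} \<epsilon> R" for R \<epsilon>
  proof -
    obtain C where C: "C \<in> Ch \<epsilon>" "R = {C}" using residue_empty[OF R] by blast
    then have "is_residue W S Ch \<delta> {} (\<not> \<epsilon>) (\<theta> ` R)"
      using singleton_residue[OF swap[OF C(1)]] by simp
    then show ?thesis
      using R C opp[OF C(1)] unfolding opposite_residues_def by auto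
  qed
  then show ?thesis
    using opp in_twin_chambers unfolding J_opposite_def by auto
qed

end
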